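(* Let $(X,d)$ be a (nonempty) compact metric space and $\alpha:X\to X$ a continuous map that is a finite-sheeted cover on its essential set $X_\alpha$, i.e. $\sup_{x\in X_\alpha}|\alpha^{-1}(x)\cap X_\alpha|<\infty$. Then $$h(\alpha)\le\gamma(\alpha)+\omega(\alpha).$$
   Context: $M_\alpha(X)$ is the set of Borel $\alpha$-invariant probability measures on $X$. A point $x\in X$ is essential if every neighborhood $V$ of $x$ satisfies $\mu(V)>0$ for some $\mu\in M_\alpha(X)$; $X_\alpha$ is the (closed) set of essential points, and $\alpha(X_\alpha)=X_\alpha$. For $x\in X_\alpha$ put $\tilde\alpha^{-n}(x):=\alpha^{-n}(x)\cap X_\alpha$. Put $d_n(x,y):=\max_{0\le i\le n-1}d(\alpha^i(x),\alpha^i(y))$. A set $E\subset X$ is $(n,\varepsilon)$-spanning if for every $x\in X$ there is $y\in E$ with $d_n(x,y)<\varepsilon$; a set $E\subset X_\alpha$ is $(n,\varepsilon)$-spanning for $X_\alpha$ if for every $x\in X_\alpha$ there is $y\in E$ with $d_n(x,y)<\varepsilon$. Topological entropy: $h(\alpha):=\ln\lim_{\varepsilon\to0}\limsup_{n\to\infty}\inf\{|E|^{1/n}: E \text{ is }(n,\varepsilon)\text{-spanning}\}$. Inverse rami-rate: $\omega(\alpha):=\ln\limsup_{n\to\infty}\sup_{x\in X_\alpha}|\tilde\alpha^{-n}(x)|^{1/n}$. Forward entropy: $\gamma(\alpha):=\ln\lim_{\varepsilon\to0}\limsup_{n\to\infty}\inf\{|\alpha^n(E)|^{1/n}: E\text{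 is }(n,\varepsilon)\text{-spanning for }X_\alpha\}$. *)

theory Defs
  imports "HOL-Probability.Probability"
begin

text \<open>
  The compact metric space is the whole of a type of class \<open>metric_space\<close> (with \<open>UNIV\<close> assumed
  compact in the theorem); being a type, it is nonempty.

  Cardinalities and their roots live in \<^typ>\<open>ennreal\<close>, where infinite sets have cardinality
  \<open>\<infinity>\<close> (not \<open>0\<close>, as with \<^const>\<open>card\<close>), and logarithms in \<^typ>\<open>ereal\<close>.
\<close>

definition ecard :: "'a set \<Rightarrow> ennreal" where
  "ecard E = emeasure (count_space UNIV) E"

definition eroot :: "nat \<Rightarrow> ennreal \<Rightarrow> ennreal" where
  "eroot n a = (if a = \<infinity> then \<infinity> else ennreal (root n (enn2real a)))"

definition eln :: "ennreal \<Rightarrow> ereal" where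
  "eln a = (if a = 0 then -\<infinity> else if a = \<infinity> then \<infinity> else ereal (ln (enn2real a)))"

definition invariant_measures :: "('a::metric_space \<Rightarrow> 'a) \<Rightarrow> 'a measure set" where
  "invariant_measures \<alpha> = {M. prob_space M \<and> sets M = sets borel \<and> distr M borel \<alpha> = M}"

text \<open>
  It suffices to test open neighbourhoods, since every neighbourhood contains an open one; this
  avoids evaluating measures on non-measurable sets.
\<close>

definition essential_set :: "('a::metric_space \<Rightarrow> 'a) \<Rightarrow> 'a set" where
  "essential_set \<alpha> =
     {x. \<forall>V. open V \<and> x \<in> V \<longrightarrow> (\<exists>M\<in>invariant_measures \<alpha>. emeasure M V > 0)}"

definition essential_preimage :: "('a::metric_space \<Rightarrow> 'a) \<Rightarrow> nat \<Rightarrow> 'a \<Rightarrow> 'a set" where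
  "essential_preimage \<alpha> n x = (\<alpha> ^^ n) -` {x} \<inter> essential_set \<alpha>"

definition finite_sheeted_on_essential :: "('a::metric_space \<Rightarrow> 'a) \<Rightarrow> bool" where
  "finite_sheeted_on_essential \<alpha> \<longleftrightarrow>
     (SUP x\<in>essential_set \<alpha>. ecard (\<alpha> -` {x} \<inter> essential_set \<alpha>)) < \<infinity>"

text \<open>
  The value at \<open>n = 0\<close>, a maximum over the empty set, is unspecified. The quantities below depend
  only on large \<open>n\<close>.
\<close>

definition dyn_dist :: "('a::metric_space \<Rightarrow> 'a) \<Rightarrow> nat \<Rightarrow> 'a \<Rightarrow> 'a \<Rightarrow> real" where
  "dyn_dist \<alpha> n x y = (MAX i\<in>{..<n}. dist ((\<alpha> ^^ i) x) ((\<alpha> ^^ i) y))"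

definition spanning ::
  "('a::metric_space \<Rightarrow> 'a) \<Rightarrow> 'a set \<Rightarrow> nat \<Rightarrow> real \<Rightarrow> 'a set \<Rightarrow> bool" where
  "spanning \<alpha> A n \<epsilon> E \<longleftrightarrow> E \<subseteq> A \<and> (\<forall>x\<in>A. \<exists>y\<in>E. dyn_dist \<alpha> n x y < \<epsilon>)"

text \<open>
  The limits in \<open>\<epsilon>\<close> below exist in \<^typ>\<open>ennreal\<close>, because the functions of \<open>\<epsilon>\<close> are antitone.
\<close>

definition topological_entropy :: "('a::metric_space \<Rightarrow> 'a) \<Rightarrow> ereal" where
  "topological_entropy \<alpha> =
     eln (Lim (at_right 0) (\<lambda>\<epsilon>. limsup (\<lambda>n.
       INF E\<in>{E. spanning \<alpha> UNIV n \<epsilon> E}. eroot n (ecard E))))"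

definition inverse_rami_rate :: "('a::metric_space \<Rightarrow> 'a) \<Rightarrow> ereal" where
  "inverse_rami_rate \<alpha> =
     eln (limsup (\<lambda>n. SUP x\<in>essential_set \<alpha>. eroot n (ecard (essential_preimage \<alpha> n x))))"

definition forward_entropy :: "('a::metric_space \<Rightarrow> 'a) \<Rightarrow> ereal" where
  "forward_entropy \<alpha> =
     eln (Lim (at_right 0) (\<lambda>\<epsilon>. limsup (\<lambda>n.
       INF E\<in>{E. spanning \<alpha> (essential_set \<alpha>) n \<epsilon> E}. eroot n (ecard ((\<alpha> ^^ n) ` E)))))"

end

theory Submission
  imports Defs
begin

text \<open>
  The main point is that the entropy of \<open>\<alpha>\<close> is carried by the essential set. If orbits of unbounded
  length spent a positive fraction of time outside an open \<open>U \<supseteq> X\<^sub>\<alpha>\<close>, a cluster point of the visiting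
  frequencies, taken as set functions, would be a finitely additive \<open>\<alpha>\<close>-invariant content, and
  the Borel measure built from it would be invariant and charge the complement of \<open>U\<close>. Hence all
  orbits spend a uniformly vanishing fraction of time outside \<open>U\<close>. Taking for \<open>U\<close> the union of
  the \<open>(N, \<epsilon>)\<close>-balls around an \<open>(N, \<epsilon>)\<close>-spanning set \<open>E\<close> of \<open>X\<^sub>\<alpha>\<close>, an orbit of length \<open>n\<close> is shadowed
  by about \<open>n / N\<close> blocks from \<open>E\<close> and \<open>o(n)\<close> single points of an \<open>\<epsilon>\<close>-net, so spanning sets of \<open>X\<close>
  grow no faster than those of \<open>X\<^sub>\<alpha>\<close>. For the latter, \<open>|E| \<le> |\<alpha>\<^sup>n(E)| \<cdot> sup\<^sub>x |\<alpha>\<^sup>-\<^sup>n(x) \<inter> X\<^sub>\<alpha>|\<close>.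
\<close>

section \<open>The measure generated by a finitely additive content\<close>

text \<open>The classical passage from a content on compact sets to a Borel measure: inner values
  for open sets, then an outer measure for all sets. Closed sets stand in for compact ones, the
  ambient space being compact in the locale below.\<close>

definition inner_content :: "('a::topological_space set \<Rightarrow> ennreal) \<Rightarrow> 'a set \<Rightarrow> ennreal" where
  "inner_content m V = (SUP L\<in>{L. closed L \<and> L \<subseteq> V}. m L)"

definition content_outer :: "('a::topological_space set \<Rightarrow> ennreal) \<Rightarrow> 'a set \<Rightarrow> ennreal" where
  "content_outer m A = (INF V\<in>{V. open V \<and> A \<subseteq> V}. inner_content m V)"

text \<open>\<open>m\<close> is only finitely additive, but on all subsets, as for a limit of
  visiting frequencies; countable additivity has to come from compactness.\<close>

locale compact_content =
  fixes m :: "'a::metric_space set \<Rightarrow> ennreal"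
  assumes compact_space: "compact (UNIV :: 'a set)"
    and additive: "A \<inter> B = {} \<Longrightarrow> m (A \<union> B) = m A + m B"
    and total: "m UNIV = 1"
begin

lemma mono: "A \<subseteq> B \<Longrightarrow> m A \<le> m B"
  using additive[of A "B - A"] by (simp add: Un_absorb1)

lemma subadditive: "m (A \<union> B) \<le> m A + m B"
  using additive[of A "B - A"] mono[of "B - A" B] by (simp add: add_left_mono)

lemma empty: "m {} = 0"
proof -
  have "m UNIV = m {} + m UNIV"
    using additive[of "{}" UNIV] by simp
  then show ?thesis
    using ennreal_add_left_cancel[of 1 0 "m {}"] by (simp add: total add.commute)
qed

lemma inner_content_mono: "V \<subseteq> W \<Longrightarrow> inner_content m V \<le> inner_content m W"
  unfolding inner_content_def by (intro SUP_subset_mono) auto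

lemma content_outer_open: "open V \<Longrightarrow> content_outer m V = inner_content m V"
  unfolding content_outer_def
  by (intro antisym INF_lower INF_greatest) (auto intro: inner_content_mono)

lemma inner_content_lower: "closed L \<Longrightarrow> L \<subseteq> V \<Longrightarrow> m L \<le> inner_content m V"
  unfolding inner_content_def by (intro SUP_upper) auto

text \<open>The generated measure may differ from \<open>m\<close>, but on closed sets it can only
  be larger; this later carries a lower bound for \<open>m (- U)\<close> over to the
  measure.\<close>

lemma content_le_outer: "closed L \<Longrightarrow> m L \<le> content_outer m L"
  unfolding content_outer_def by (intro INF_greatest) (auto intro: inner_content_lower)

lemma inner_content_empty: "inner_content m {} = 0"
  unfolding inner_content_def by (auto simp: empty intro!: antisym SUP_least)

lemma content_outer_UNIV: "content_outer m UNIV = 1"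
proof (rule antisym)
  show "content_outer m UNIV \<le> 1"
    using mono[of _ UNIV]
    by (auto simp: content_outer_open inner_content_def total intro!: SUP_least)
  show "1 \<le> content_outer m UNIV"
    using content_le_outer[of UNIV] total by simp
qed

text \<open>By normality the disjoint closed sets \<open>L - V\<close> and \<open>L - W\<close> have
  disjoint open neighbourhoods \<open>P\<close> and \<open>Q\<close>, which cut \<open>L\<close>
  into the closed pieces \<open>L - P\<close> inside \<open>V\<close> and \<open>L - Q\<close>
  inside \<open>W\<close>.\<close>

lemma inner_content_Un:
  assumes "open V" "open W"
  shows "inner_content m (V \<union> W) \<le> inner_content m V + inner_content m W"
  unfolding inner_content_def[of m "V \<union> W"]
proof (rule SUP_least, clarify)
  fix L assume L: "closed L" "L \<subseteq> V \<union> W"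
  have "(L - V) \<inter> (L - W) = {}"
    using L by blast
  then obtain P Q where PQ: "open P" "open Q" "L - V \<subseteq> P" "L - W \<subseteq> Q" "P \<inter> Q = {}"
    using t4_space[of "L - V" "L - W"] L assms closed_Diff by blast
  have L_eq: "L = (L - P) \<union> (L - Q)"
    using PQ(5) by blast
  have "m L \<le> m (L - P) + m (L - Q)"
    by (subst L_eq) (rule subadditive)
  also have "\<dots> \<le> inner_content m V + inner_content m W"
    using L PQ by (intro add_mono inner_content_lower) (auto intro: closed_Diff)
  finally show "m L \<le> inner_content m V + inner_content m W" .
qed

lemma inner_content_UN_finite:
  assumes "\<And>i::nat. open (V i)"
  shows "inner_content m (\<Union>i<k. V i) \<le> (\<Sum>i<k. inner_content m (V i))"
proof (induction k)
  case 0
  then show ?case by (simp add: inner_content_empty)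
next
  case (Suc k)
  have "inner_content m (\<Union>i<Suc k. V i) \<le> inner_content m (\<Union>i<k. V i) + inner_content m (V k)"
    using inner_content_Un[of "\<Union>i<k. V i" "V k"] assms by (auto simp: lessThan_Suc Un_commute)
  also have "\<dots> \<le> (\<Sum>i<Suc k. inner_content m (V i))"
    using Suc by (simp add: add_right_mono)
  finally show ?case .
qed

text \<open>A closed \<open>L\<close> is compact, so finitely many of the \<open>V i\<close> already
  cover it; this is where countable subadditivity originates.\<close>

lemma inner_content_UN:
  assumes V: "\<And>i::nat. open (V i)"
  shows "inner_content m (\<Union>i. V i) \<le> (\<Sum>i. inner_content m (V i))"
  unfolding inner_content_def[of m "\<Union>i. V i"]
proof (rule SUP_least, clarify)
  fix L assume L: "closed L" "L \<subseteq> (\<Union>i. V i)"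
  have "compact L"
    using compact_Int_closed[OF compact_space L(1)] by simp
  then obtain I where I: "finite I" "L \<subseteq> (\<Union>i\<in>I. V i)"
    using compactE_image[of L UNIV V] L V by auto
  obtain k where "I \<subseteq> {..<k}"
    using I(1) finite_nat_iff_bounded by blast
  with I have "L \<subseteq> (\<Union>i<k. V i)" by blast
  then have "m L \<le> inner_content m (\<Union>i<k. V i)"
    using L by (intro inner_content_lower)
  also have "\<dots> \<le> (\<Sum>i<k. inner_content m (V i))"
    by (rule inner_content_UN_finite[OF V])
  also have "\<dots> \<le> (\<Sum>i. inner_content m (V i))"
    by (intro sum_le_suminf) auto
  finally show "m L \<le> (\<Sum>i. inner_content m (V i))" .
qed

section \<open>Caratheodory measurability of the Borel sets\<close>

lemma content_outer_close:
  "content_outer m A < c \<Longrightarrow> \<exists>V. open V \<and> A \<subseteq> V \<and> inner_content m V < c"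
  unfolding content_outer_def INF_less_iff by auto

lemma outer_measure_space_content: "outer_measure_space (Pow UNIV) (content_outer m)"
  unfolding outer_measure_space_def positive_def increasing_def countably_subadditive_def
proof (intro conjI ballI allI impI)
  show "content_outer m {} = 0"
    by (simp add: content_outer_open inner_content_empty)
  show "content_outer m A \<le> content_outer m B" if "A \<subseteq> B" for A B
    unfolding content_outer_def using that by (intro INF_superset_mono) auto
  fix A :: "nat \<Rightarrow> 'a set"
  show "content_outer m (\<Union>i. A i) \<le> (\<Sum>i. content_outer m (A i))"
  proof (rule ennreal_le_epsilon)
    fix e :: real assume e: "0 < e" and "(\<Sum>i. content_outer m (A i)) < top"
    \<comment> \<open>Each summand is finite because the series is, so adding a positive amount is a
      strict increase and leaves room for an open set.\<close>
    then have "content_outer m (A i) < content_outer m (A i) + e * (1/2) ^ Suc i" for i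
      by (auto simp add: less_top dest!: ennreal_suminf_lessD)
    then have "\<forall>i. \<exists>V. open V \<and> A i \<subseteq> V \<and> inner_content m V < content_outer m (A i) + e * (1/2) ^ Suc i"
      by (intro allI content_outer_close)
    from choice[OF this] obtain V where V: "\<And>i. open (V i)" "\<And>i. A i \<subseteq> V i"
      "\<And>i. inner_content m (V i) < content_outer m (A i) + e * (1/2) ^ Suc i"
      by blast
    have "content_outer m (\<Union>i. A i) \<le> inner_content m (\<Union>i. V i)"
      unfolding content_outer_def[of m "\<Union>i. A i"] using V by (intro INF_lower) blast
    also have "\<dots> \<le> (\<Sum>i. inner_content m (V i))"
      by (rule inner_content_UN[OF V(1)])
    also have "\<dots> \<le> (\<Sum>i. content_outer m (A i) + e * (1/2) ^ Suc i)"
      by (intro suminf_le less_imp_le V) auto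
    also have "\<dots> = (\<Sum>i. content_outer m (A i)) + (\<Sum>i. ennreal e * ennreal ((1/2) ^ Suc i))"
      using e by (subst suminf_add[symmetric])
                 (auto simp del: ennreal_suminf_cmult simp add: ennreal_mult[symmetric])
    also have "\<dots> = (\<Sum>i. content_outer m (A i)) + e"
      unfolding ennreal_suminf_cmult
      by (subst suminf_ennreal_eq[OF zero_le_power power_half_series]) auto
    finally show "content_outer m (\<Union>i. A i) \<le> (\<Sum>i. content_outer m (A i)) + e" .
  qed
qed

text \<open>For open \<open>V\<close> containing \<open>A\<close> and closed \<open>L\<close> inside
  \<open>V - C\<close>, the set \<open>V - L\<close> is an open neighbourhood of
  \<open>V \<inter> C\<close>. Any closed \<open>K\<close> inside it is disjoint from
  \<open>L\<close>, so \<open>m\<close> is additive on \<open>K \<union> L\<close>; suprema are then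
  taken over \<open>K\<close> and over \<open>L\<close>.\<close>

lemma content_outer_split:
  assumes C: "closed C"
  shows "content_outer m (A \<inter> C) + content_outer m (A - C) \<le> content_outer m A"
  unfolding content_outer_def[of m A]
proof (rule INF_greatest, clarify)
  fix V assume V: "open V" "A \<subseteq> V"
  have inc: "content_outer m S \<le> content_outer m T" if "S \<subseteq> T" for S T
    using outer_measure_space_content that unfolding outer_measure_space_def increasing_def by auto
  have VC: "open (V - C)"
    using V C by auto
  have *: "content_outer m (V \<inter> C) + m L \<le> inner_content m V" if L: "closed L" "L \<subseteq> V - C" for L
  proof -
    have "content_outer m (V \<inter> C) \<le> inner_content m (V - L)"
      unfolding content_outer_def using V L by (intro INF_lower) auto
    then have "content_outer m (V \<inter> C) + m L \<le> inner_content m (V - L) + m L"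
      by (rule add_right_mono)
    also have "\<dots> = (SUP K\<in>{K. closed K \<and> K \<subseteq> V - L}. m K + m L)"
      unfolding inner_content_def
      by (subst ennreal_SUP_add_left) auto
    also have "\<dots> \<le> inner_content m V"
    proof (rule SUP_least, clarify)
      fix K assume K: "closed K" "K \<subseteq> V - L"
      then have "m K + m L = m (K \<union> L)"
        by (subst additive) auto
      also have "\<dots> \<le> inner_content m V"
        using K L by (intro inner_content_lower) auto
      finally show "m K + m L \<le> inner_content m V" .
    qed
    finally show ?thesis .
  qed
  have "content_outer m (A \<inter> C) + content_outer m (A - C) \<le> content_outer m (V \<inter> C) + inner_content m (V - C)"
    using V VC by (intro add_mono inc) (auto simp flip: content_outer_open intro!: inc)
  also have "\<dots> = (SUP L\<in>{L. closed L \<and> L \<subseteq> V - C}. content_outer m (V \<inter> C) + m L)"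
    unfolding inner_content_def
    by (subst ennreal_SUP_add_right) auto
  also have "\<dots> \<le> inner_content m V"
    using * by (intro SUP_least) auto
  finally show "content_outer m (A \<inter> C) + content_outer m (A - C) \<le> inner_content m V" .
qed

lemma measure_space_content: "measure_space UNIV (sets borel) (content_outer m)"
proof -
  let ?L = "lambda_system UNIV (Pow UNIV) (content_outer m)"
  note oms = outer_measure_space_content
  have ms: "measure_space UNIV ?L (content_outer m)"
    by (rule sigma_algebra.caratheodory_lemma[OF sigma_algebra_Pow oms])
  have "C \<in> ?L" if C: "closed C" for C
  proof -
    \<comment> \<open>The reverse of the splitting inequality, by subadditivity; equality is
      Caratheodory's condition for \<open>C\<close>.\<close>
    have "content_outer m A \<le> content_outer m (A \<inter> C) + content_outer m (A - C)" for A
    proof -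
      have "subadditive (Pow UNIV) (content_outer m)"
        using oms unfolding outer_measure_space_def
        by (intro ring_of_sets.countably_subadditive_subadditive[OF algebra.axioms(1)[OF algebra_Pow]]) auto
      from subadditiveD[OF this, of "A \<inter> C" "A - C"] show ?thesis
        by (simp add: Int_Diff_Un Int_Diff_disjoint)
    qed
    with content_outer_split[OF C] show ?thesis
      unfolding algebra.lambda_system_eq[OF algebra_Pow] by (auto intro: antisym)
  qed
  moreover have sa: "sigma_algebra UNIV ?L"
    using ms by (simp add: measure_space_def)
  ultimately have "sets borel \<subseteq> ?L"
    unfolding borel_eq_closed
    using sigma_algebra.sigma_sets_subset[OF sa, of "Collect closed"] by auto
  then show ?thesis
    using measure_down[OF ms] sets.sigma_algebra_axioms[of borel] by (simp add: space_borel)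
qed

section \<open>The generated Borel probability measure\<close>

definition content_measure :: "'a measure" where
  "content_measure = measure_of UNIV (sets borel) (content_outer m)"

lemma sets_content_measure [measurable_cong]: "sets content_measure = sets borel"
  unfolding content_measure_def
  using sets.sigma_sets_eq[of borel] by (simp add: sets_measure_of)

lemma space_content_measure: "space content_measure = UNIV"
  by (simp add: content_measure_def space_measure_of_conv)

lemma emeasure_content_measure:
  "A \<in> sets borel \<Longrightarrow> emeasure content_measure A = content_outer m A"
  using measure_space_content unfolding content_measure_def measure_space_def
  by (intro emeasure_measure_of_sigma) auto

lemma prob_space_content_measure: "prob_space content_measure"
  by (intro prob_spaceI)
     (simp add: space_content_measure emeasure_content_measure content_outer_UNIV)

lemma content_measure_invariant:
  assumes cont: "continuous_on UNIV f" and inv: "\<And>A. m (f -` A) = m A"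
  shows "distr content_measure borel f = content_measure"
proof -
  have f [measurable]: "f \<in> borel_measurable borel"
    by (rule borel_measurable_continuous_onI[OF cont])
  have f': "f \<in> content_measure \<rightarrow>\<^sub>M borel"
    by measurable
  interpret prob_space content_measure
    by (rule prob_space_content_measure)
  \<comment> \<open>For the outer measure only \<open>\<le>\<close> is visible; passing to complements turns it into equality.\<close>
  have open_le: "inner_content m (f -` V) \<le> inner_content m V" if "open V" for V
    unfolding inner_content_def[of m "f -` V"]
  proof (rule SUP_least, clarify)
    fix L assume L: "closed L" "L \<subseteq> f -` V"
    have "compact L"
      using compact_Int_closed[OF compact_space L(1)] by simp
    then have "closed (f ` L)"
      using cont by (meson compact_continuous_image compact_imp_closed continuous_on_subset subset_UNIV)
    \<comment> \<open>\<open>L\<close> need not be a full preimage; enlarging it to the preimage of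
      its image, which is compact and hence closed, makes the invariance of \<open>m\<close>
      applicable.\<close>
    have "m L \<le> m (f -` f ` L)"
      by (intro mono) auto
    also have "\<dots> \<le> inner_content m V"
      unfolding inv using L \<open>closed (f ` L)\<close> by (intro inner_content_lower) auto
    finally show "m L \<le> inner_content m V" .
  qed
  have le: "content_outer m (f -` A) \<le> content_outer m A" for A
    unfolding content_outer_def[of m A]
  proof (rule INF_greatest, clarify)
    fix V assume V: "open V" "A \<subseteq> V"
    then have "open (f -` V)"
      using cont by (simp add: open_vimage)
    then have "content_outer m (f -` A) \<le> inner_content m (f -` V)"
      unfolding content_outer_def using V by (intro INF_lower) auto
    with open_le[OF V(1)] show "content_outer m (f -` A) \<le> inner_content m V"
      by (rule order_trans[rotated])
  qed
  have le': "prob (f -` A) \<le> prob A" if "A \<in> sets borel" for A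
  proof -
    have "f -` A \<in> sets borel"
      using measurable_sets[OF f that] by simp
    with le[of A] that have "emeasure content_measure (f -` A) \<le> emeasure content_measure A"
      by (simp add: emeasure_content_measure)
    then show ?thesis
      by (simp add: emeasure_eq_measure)
  qed
  show ?thesis
  proof (rule measure_eqI)
    fix A assume "A \<in> sets (distr content_measure borel f)"
    then have A: "A \<in> sets borel" by simp
    have B: "f -` A \<in> sets borel"
      using measurable_sets[OF f A] by simp
    have "prob (f -` A) = prob A"
    proof (rule antisym)
      show "prob A \<le> prob (f -` A)"
        using le'[of "UNIV - A"] A B prob_compl[of A] prob_compl[of "f -` A"]
        by (simp add: sets_content_measure space_content_measure vimage_Diff)
    qed (rule le'[OF A])
    then show "emeasure (distr content_measure borel f) A = emeasure content_measure A"
      using A f' by (simp add: emeasure_distr space_content_measure emeasure_eq_measure)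
  qed (simp add: sets_content_measure)
qed

end

section \<open>Visiting frequencies and the essential set\<close>

definition visits :: "('a \<Rightarrow> 'a) \<Rightarrow> 'a \<Rightarrow> nat \<Rightarrow> 'a set \<Rightarrow> nat" where
  "visits f x n A = (\<Sum>i<n. of_bool ((f ^^ i) x \<in> A))"

lemma visits_0 [simp]: "visits f x 0 A = 0"
  by (simp add: visits_def)

lemma visits_Suc: "visits f x (Suc n) A = of_bool (x \<in> A) + visits f (f x) n A"
  by (simp add: visits_def sum.lessThan_Suc_shift funpow_swap1 del: sum.lessThan_Suc)

lemma visits_Suc_right: "visits f x (Suc n) A = visits f x n A + of_bool ((f ^^ n) x \<in> A)"
  by (simp add: visits_def)

lemma visits_vimage: "visits f x n (f -` A) = visits f (f x) n A"
  by (simp add: visits_def funpow_swap1)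

text \<open>Shifting the orbit by one step affects only the terms at times \<open>0\<close> and
  \<open>n\<close>, so the discrepancy vanishes after division by \<open>n\<close>; this is the
  source of invariance of the limit.\<close>

lemma visits_vimage_bounds:
  "visits f x n (f -` A) \<le> visits f x n A + 1" "visits f x n A \<le> visits f x n (f -` A) + 1"
  using visits_Suc[of f x n A] visits_Suc_right[of f x n A]
  by (simp_all add: visits_vimage of_bool_def split: if_splits)

lemma visits_Un_disjoint: "A \<inter> B = {} \<Longrightarrow> visits f x n (A \<union> B) = visits f x n A + visits f x n B"
  unfolding visits_def sum.distrib[symmetric] by (intro sum.cong) auto

lemma visits_UNIV: "visits f x n UNIV = n"
  by (simp add: visits_def)

text \<open>The orbit from time \<open>k\<close> on is a tail of the original one. For
  \<open>k > n\<close> the truncated \<open>n - k\<close> is \<open>0\<close>, which covers a last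
  block that sticks out beyond time \<open>n\<close>.\<close>

lemma visits_shift_le: "visits f ((f ^^ k) x) (n - k) A \<le> visits f x n A"
proof (induction k arbitrary: n x)
  case (Suc k)
  show ?case
  proof (cases n)
    case [simp]: (Suc n')
    have "visits f ((f ^^ k) (f x)) (n' - k) A \<le> visits f (f x) n' A"
      by (rule Suc.IH)
    then show ?thesis
      by (simp add: visits_Suc funpow_swap1)
  qed simp
qed simp

section \<open>Invariant contents as limits of visiting frequencies\<close>

lemma compact_UNIV_fun_ennreal: "compact (UNIV :: ('a \<Rightarrow> ennreal) set)"
proof -
  \<comment> \<open>Tychonoff's theorem, applied to copies of the compact space
    \<open>ennreal\<close>.\<close>
  have "compact_space (euclidean :: ennreal topology)"
    by (simp add: compact_space_def compact_UNIV)
  then have "compact_space (product_topology (\<lambda>_::'a. euclidean :: ennreal topology) UNIV)"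
    by (simp add: compact_space_product_topology)
  then show ?thesis
    by (simp add: compact_space_def euclidean_product_topology)
qed

text \<open>The Krylov-Bogolyubov argument with set functions in place of measures: a cluster point
  of the frequencies inherits additivity and bounds pointwise, and becomes invariant because the
  error \<open>1 / N k\<close> tends to \<open>0\<close>. The base points \<open>x k\<close> may
  vary.\<close>

lemma invariant_content_of_empirical:
  fixes x :: "nat \<Rightarrow> 'a" and N :: "nat \<Rightarrow> nat"
  assumes N: "filterlim N at_top sequentially" and le: "\<And>k. c * real (N k) \<le> real (visits f (x k) (N k) L)"
  obtains m :: "'a set \<Rightarrow> ennreal"
  where "\<And>A B. A \<inter> B = {} \<Longrightarrow> m (A \<union> B) = m A + m B" "m UNIV = 1"
    "\<And>A. m (f -` A) = m A" "ennreal c \<le> m L"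
proof -
  define e where "e k A = ennreal (real (visits f (x k) (N k) A) / real (N k))" for k A
  have "filtermap e sequentially \<noteq> bot"
    by (simp add: filtermap_bot_iff)
  then obtain m where m: "inf (nhds m) (filtermap e sequentially) \<noteq> bot"
    using compact_UNIV_fun_ennreal[unfolded compact_filter] by fastforce
  \<comment> \<open>\<open>F\<close> plays the role of a subsequence along which \<open>e\<close>
    converges to \<open>m\<close>; a filter is used since the product need not be sequentially
    compact. It is proper because \<open>m\<close> is a cluster point.\<close>
  define F where "F = inf (filtercomap e (nhds m)) sequentially"
  have F: "F \<noteq> bot"
  proof
    assume "F = bot"
    then have "eventually (\<lambda>_. False) F" by simp
    then obtain P Q where PQ: "eventually P (nhds m)" "eventually Q sequentially" "\<And>k. P (e k) \<Longrightarrow> Q k \<Longrightarrow> False"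
      unfolding F_def eventually_inf eventually_filtercomap by blast
    then have "eventually (\<lambda>y. \<not> P y) (filtermap e sequentially)"
      unfolding eventually_filtermap by (blast intro: eventually_mono)
    with PQ(1) have "eventually (\<lambda>_. False) (inf (nhds m) (filtermap e sequentially))"
      unfolding eventually_inf by blast
    with m show False by (simp add: eventually_False)
  qed
  have "filterlim e (nhds m) F"
    unfolding F_def by (rule filterlim_mono[OF filterlim_filtercomap order_refl inf_le1])
  then have lim: "((\<lambda>k. e k A) \<longlongrightarrow> m A) F" for A
    by (rule continuous_on_tendsto_compose[OF continuous_on_product_coordinates]) auto
  have F_le: "F \<le> sequentially"
    by (simp add: F_def)
  \<comment> \<open>Where \<open>N k = 0\<close>, division makes all frequencies \<open>0\<close>;
    normalisation and the lower bound are therefore claimed only for positive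
    \<open>N k\<close>.\<close>
  have pos: "eventually (\<lambda>k. N k > 0) F"
    by (rule filter_leD[OF F_le eventually_compose_filterlim[OF eventually_gt_at_top N]])
  have inverse_lim: "((\<lambda>k. ennreal (1 / real (N k))) \<longlongrightarrow> 0) F"
  proof -
    have "((\<lambda>k. 1 / real (N k)) \<longlongrightarrow> 0) sequentially"
      by (rule filterlim_compose[OF lim_1_over_n N])
    then have "((\<lambda>k. ennreal (1 / real (N k))) \<longlongrightarrow> ennreal 0) sequentially"
      by (rule tendsto_ennrealI)
    then show ?thesis
      using tendsto_mono[OF F_le] by simp
  qed
  have e_le: "e k A \<le> e k B + ennreal (1 / real (N k))"
    if "visits f (x k) (N k) A \<le> visits f (x k) (N k) B + 1" for k A B
  proof -
    have "real (visits f (x k) (N k) A) / real (N k) \<le> real (visits f (x k) (N k) B) / real (N k) + 1 / real (N k)"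
      using that by (simp add: divide_right_mono flip: add_divide_distrib)
    then show ?thesis
      unfolding e_def by (simp flip: ennreal_plus add: ennreal_leI)
  qed
  have m_le: "m A \<le> m B" if "\<And>k. visits f (x k) (N k) A \<le> visits f (x k) (N k) B + 1" for A B
  proof -
    have "((\<lambda>k. e k B + ennreal (1 / real (N k))) \<longlongrightarrow> m B + 0) F"
      by (intro tendsto_add lim inverse_lim)
    from tendsto_le[OF F this lim[of A]] show ?thesis
      using e_le that by simp
  qed
  show ?thesis
  proof
    show "m (A \<union> B) = m A + m B" if "A \<inter> B = {}" for A B
    proof (rule tendsto_unique[OF F lim])
      have "e k (A \<union> B) = e k A + e k B" for k
        unfolding e_def visits_Un_disjoint[OF that] by (simp add: add_divide_distrib flip: ennreal_plus)
      then show "((\<lambda>k. e k (A \<union> B)) \<longlongrightarrow> m A + m B) F"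
        by (simp add: tendsto_add lim)
    qed
    show "m UNIV = 1"
    proof (rule tendsto_unique[OF F lim])
      have "eventually (\<lambda>k. e k UNIV = 1) F"
        using pos by eventually_elim (simp add: e_def visits_UNIV)
      then show "((\<lambda>k. e k UNIV) \<longlongrightarrow> 1) F"
        by (rule tendsto_eventually)
    qed
    show "m (f -` A) = m A" for A
      by (intro antisym m_le visits_vimage_bounds)
    have "eventually (\<lambda>k. ennreal c \<le> e k L) F"
      using pos by eventually_elim (use le in \<open>auto simp: e_def field_simps intro!: ennreal_leI\<close>)
    from tendsto_le[OF F lim tendsto_const this] show "ennreal c \<le> m L" .
  qed
qed

section \<open>Invariant measures and orbits off the essential set\<close>

lemma emeasure_outside_essential_set:
  assumes X: "compact (UNIV :: 'a::metric_space set)" and M: "M \<in> invariant_measures f"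
    and L: "closed L" "L \<inter> essential_set f = ({} :: 'a set)"
  shows "emeasure M L = 0"
proof -
  have sets_M: "sets M = sets borel"
    using M by (simp add: invariant_measures_def)
  \<comment> \<open>Nonessential points have an open neighbourhood that is null for every invariant
    measure; by compactness finitely many of these cover \<open>L\<close>.\<close>
  have "\<exists>V. open V \<and> x \<in> V \<and> emeasure M V = 0" if "x \<in> L" for x
  proof -
    have "x \<notin> essential_set f"
      using that L(2) by blast
    then obtain V where "open V" "x \<in> V" "\<not> (\<exists>M\<in>invariant_measures f. emeasure M V > 0)"
      unfolding essential_set_def by blast
    with M show ?thesis
      by (metis not_gr_zero)
  qed
  then obtain V where V: "\<And>x. x \<in> L \<Longrightarrow> open (V x) \<and> x \<in> V x \<and> emeasure M (V x) = 0"
    by metis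
  have "compact L"
    using compact_Int_closed[OF X L(1)] by simp
  moreover have "\<And>x. x \<in> L \<Longrightarrow> open (V x)" "L \<subseteq> (\<Union>x\<in>L. V x)"
    using V by auto
  ultimately obtain I where I: "I \<subseteq> L" "finite I" "L \<subseteq> (\<Union>x\<in>I. V x)"
    by (rule compactE_image)
  have "emeasure M L \<le> emeasure M (\<Union>x\<in>I. V x)"
    using I V by (intro emeasure_mono) (auto simp: sets_M intro!: borel_open)
  also have "\<dots> \<le> (\<Sum>x\<in>I. emeasure M (V x))"
    using I V by (intro emeasure_subadditive_finite) (auto simp: sets_M intro!: borel_open)
  also have "\<dots> = 0"
    using I V by (intro sum.neutral) auto
  finally show ?thesis by simp
qed

text \<open>If no \<open>n0\<close> served all \<open>x\<close> at once, there would be orbit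
  segments of lengths \<open>N k\<close> tending to infinity with too many visits to
  \<open>- U\<close>. Their starting points differ, yet they yield a single invariant measure
  charging the closed set \<open>- U\<close>, which misses the essential set.\<close>

lemma visits_outside_essential_set:
  assumes X: "compact (UNIV :: 'a::metric_space set)" and f: "continuous_on UNIV (f :: 'a \<Rightarrow> 'a)"
    and U: "open U" "essential_set f \<subseteq> U" and c: "c > 0"
  shows "\<exists>n0. \<forall>n\<ge>n0. \<forall>x. real (visits f x n (- U)) \<le> c * real n"
proof (rule ccontr)
  assume "\<not> ?thesis"
  then have "\<forall>k. \<exists>n x. n \<ge> k \<and> \<not> real (visits f x n (- U)) \<le> c * real n"
    by blast
  then obtain N x where N: "\<And>k. N k \<ge> k"
    and le: "\<And>k. c * real (N k) \<le> real (visits f (x k) (N k) (- U))"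
    by (metis linear)
  have "filterlim N at_top sequentially"
    by (rule filterlim_at_top_mono[OF filterlim_ident]) (simp add: N)
  from invariant_content_of_empirical[OF this le] obtain m
    where m: "\<And>A B. A \<inter> B = {} \<Longrightarrow> m (A \<union> B) = m A + m B" "m UNIV = 1"
      "\<And>A. m (f -` A) = m A" "ennreal c \<le> m (- U)"
    by metis
  interpret compact_content m
    using X m by unfold_locales auto
  have L: "closed (- U)"
    using U by (simp add: closed_def)
  have "content_measure \<in> invariant_measures f"
    using prob_space_content_measure sets_content_measure content_measure_invariant[OF f m(3)]
    by (simp add: invariant_measures_def)
  then have "emeasure content_measure (- U) = 0"
    using emeasure_outside_essential_set[OF X _ L] U by auto
  moreover have "m (- U) \<le> emeasure content_measure (- U)"
    using L content_le_outer[OF L] by (simp add: emeasure_content_measure)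
  ultimately show False
    using m(4) c by simp
qed

text \<open>Otherwise \<open>U = {}\<close> would be admissible above, although every orbit spends
  all its time outside the empty set.\<close>

lemma essential_set_nonempty:
  assumes "compact (UNIV :: 'a::metric_space set)" and "continuous_on UNIV (f :: 'a \<Rightarrow> 'a)"
  shows "essential_set f \<noteq> {}"
proof
  assume "essential_set f = {}"
  then obtain n0 where "\<forall>n\<ge>n0. \<forall>x. real (visits f x n (- {})) \<le> 1/2 * real n"
    using visits_outside_essential_set[OF assms, of "{}" "1/2"] by auto
  \<comment> \<open>\<open>Suc n0\<close> makes the length positive, so that it exceeds its half;
    \<open>undefined\<close> serves as an arbitrary point.\<close>
  from this[rule_format, of "Suc n0" undefined] show False
    by (simp add: visits_UNIV)
qed

text \<open>An invariant measure gives \<open>V\<close> the same mass as its preimage, which is a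
  neighbourhood of \<open>x\<close>.\<close>

lemma essential_set_forward_invariant:
  assumes f: "continuous_on UNIV f" and x: "x \<in> essential_set f"
  shows "f x \<in> essential_set f"
  unfolding essential_set_def
proof (safe)
  fix V assume V: "open V" "f x \<in> V"
  then have "open (f -` V)"
    using f by (simp add: open_vimage)
  with x V obtain M where M: "M \<in> invariant_measures f" "emeasure M (f -` V) > 0"
    unfolding essential_set_def by auto
  from M(1) have inv: "distr M borel f = M" and s: "sets M = sets borel"
    by (auto simp: invariant_measures_def)
  have "f \<in> measurable M borel"
    using borel_measurable_continuous_onI[OF f] measurable_cong_sets[OF s refl] by blast
  then have "emeasure (distr M borel f) V = emeasure M (f -` V \<inter> space M)"
    using V by (intro emeasure_distr) auto
  moreover have "space M = UNIV"
    using sets_eq_imp_space_eq[OF s] by simp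
  ultimately have "emeasure M V > 0"
    using M inv by simp
  with M show "\<exists>M\<in>invariant_measures f. emeasure M V > 0"
    by blast
qed

lemma essential_set_funpow:
  "continuous_on UNIV f \<Longrightarrow> x \<in> essential_set f \<Longrightarrow> (f ^^ n) x \<in> essential_set f"
  by (induction n) (auto intro: essential_set_forward_invariant)

section \<open>Spanning sets\<close>

text \<open>
  Bad times cost one letter of \<open>F\<close> each, good times one letter of \<open>E\<close> per \<open>N\<close> steps; the factors \<open>2\<close>
  absorb the choice between the two, so that no binomial coefficients need to be estimated.
\<close>

lemma orbit_cover_count:
  fixes f :: "'a::metric_space \<Rightarrow> 'a"
  assumes N: "N > 0" and E: "finite E" "E \<noteq> {}" and F: "finite F" "F \<noteq> {}"
    and net: "\<And>x :: 'a. \<exists>p\<in>F. dist x p < \<epsilon>"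
  defines "U \<equiv> {x. \<exists>y\<in>E. \<forall>i<N. dist ((f ^^ i) x) ((f ^^ i) y) < \<epsilon>}"
  shows "\<exists>\<P>. finite \<P> \<and> card \<P> \<le> (2 * card E) ^ ((n + N - 1) div N) * (2 * card F) ^ b \<and>
    {x. visits f x n (- U) \<le> b} \<subseteq> \<Union>\<P> \<and>
    (\<forall>P\<in>\<P>. \<forall>x\<in>P. \<forall>y\<in>P. \<forall>i<n. dist ((f ^^ i) x) ((f ^^ i) y) < 2 * \<epsilon>)"
proof (induction n arbitrary: b rule: less_induct)
  case (less n)
  let ?A = "2 * card E" and ?B = "2 * card F" and ?c = "\<lambda>n. (n + N - 1) div N"
  have pos: "?A > 0" "?B > 0"
    using E F by (auto simp: card_gt_0_iff)
  show ?case
  proof (cases "n = 0")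
    case True
    have "1 \<le> ?A ^ ?c n * ?B ^ b"
      using pos by (simp add: Suc_le_eq)
    then show ?thesis
      using True by (intro exI[of _ "{UNIV}"]) auto
  next
    case False
    \<comment> \<open>If \<open>x\<close> lies in \<open>U\<close>, one letter of \<open>E\<close>
      handles the first \<open>N\<close> times and a piece for length \<open>n - N\<close> the rest,
      with the same budget \<open>b\<close> of bad times.\<close>
    obtain Q where Q: "finite Q" "card Q \<le> ?A ^ ?c (n - N) * ?B ^ b"
      "{x. visits f x (n - N) (- U) \<le> b} \<subseteq> \<Union>Q"
      "\<And>P x y i. P \<in> Q \<Longrightarrow> x \<in> P \<Longrightarrow> y \<in> P \<Longrightarrow> i < n - N \<Longrightarrow> dist ((f ^^ i) x) ((f ^^ i) y) < 2 * \<epsilon>"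
      using less.IH[of "n - N" b] N False by auto
    define g where "g = (\<lambda>(y, P). {x. (\<forall>i<N. dist ((f ^^ i) x) ((f ^^ i) y) < \<epsilon>) \<and> (f ^^ N) x \<in> P})"
    define G where "G = g ` (E \<times> Q)"
    \<comment> \<open>\<open>?c n\<close> is \<open>n / N\<close> rounded up; removing a block
      lowers it by at least one, also for \<open>0 < n < N\<close>, where \<open>n - N\<close> is
      \<open>0\<close>.\<close>
    have "?c (n - N) + 1 \<le> ?c n"
    proof (cases "N \<le> n")
      case True
      then have "n + N - 1 = (n - N + N - 1) + N" using N by simp
      then show ?thesis using N by (metis Suc_eq_plus1 div_add_self2 less_irrefl order_refl)
    next
      case False
      then have "N \<le> n + N - 1" using \<open>n \<noteq> 0\<close> by linarith
      then have "?c n > 0" using N by (simp add: div_greater_zero_iff)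
      moreover have "?c (n - N) = 0" using False N by simp
      ultimately show ?thesis by linarith
    qed
    then have "?A * ?A ^ ?c (n - N) \<le> ?A ^ ?c n"
      using pos by (metis Suc_eq_plus1 power_Suc power_increasing less_eq_Suc_le One_nat_def)
    then have "?A * ?A ^ ?c (n - N) * ?B ^ b \<le> ?A ^ ?c n * ?B ^ b"
      by (rule mult_le_mono1)
    then have "2 * (card E * (?A ^ ?c (n - N) * ?B ^ b)) \<le> ?A ^ ?c n * ?B ^ b"
      by (simp only: mult.assoc)
    moreover have "card G \<le> card E * card Q"
      unfolding G_def card_cartesian_product[symmetric] using E Q by (intro card_image_le) auto
    moreover have "card E * card Q \<le> card E * (?A ^ ?c (n - N) * ?B ^ b)"
      using Q by (intro mult_le_mono2)
    ultimately have card_G: "2 * card G \<le> ?A ^ ?c n * ?B ^ b"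
      by (meson le_trans mult_le_mono2)
    have G_dist: "dist ((f ^^ i) x) ((f ^^ i) y) < 2 * \<epsilon>"
      if P: "P \<in> G" "x \<in> P" "y \<in> P" "i < n" for P x y i
    proof -
      obtain z R where z: "R \<in> Q" "P = {x. (\<forall>i<N. dist ((f ^^ i) x) ((f ^^ i) z) < \<epsilon>) \<and> (f ^^ N) x \<in> R}"
        using P(1) unfolding G_def g_def by auto
      show ?thesis
      proof (cases "i < N")
        case True
        then have "dist ((f ^^ i) x) ((f ^^ i) z) < \<epsilon>" "dist ((f ^^ i) y) ((f ^^ i) z) < \<epsilon>"
          using z P by auto
        then show ?thesis
          using dist_triangle2[of "(f ^^ i) x" "(f ^^ i) y" "(f ^^ i) z"] by linarith
      next
        case False
        then have "(f ^^ i) w = (f ^^ (i - N)) ((f ^^ N) w)" for w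
          by (metis comp_apply funpow_add le_add_diff_inverse2 not_less)
        then show ?thesis
          using Q(4)[of R "(f ^^ N) x" "(f ^^ N) y" "i - N"] z P False by auto
      qed
    qed
    have G_cover: "x \<in> \<Union>G" if "visits f x n (- U) \<le> b" "x \<in> U" for x
    proof -
      obtain y where y: "y \<in> E" "\<forall>i<N. dist ((f ^^ i) x) ((f ^^ i) y) < \<epsilon>"
        using \<open>x \<in> U\<close> unfolding U_def by auto
      have "visits f ((f ^^ N) x) (n - N) (- U) \<le> b"
        using visits_shift_le[of f N x n "- U"] that by simp
      then obtain P where P: "P \<in> Q" "(f ^^ N) x \<in> P"
        using Q(3) by auto
      have "g (y, P) \<in> G"
        unfolding G_def using y P by (intro imageI SigmaI)
      moreover have "x \<in> g (y, P)"
        using y P by (simp add: g_def)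
      ultimately show ?thesis
        by (rule UnionI)
    qed
    have "\<exists>H. finite H \<and> 2 * card H \<le> ?A ^ ?c n * ?B ^ b \<and>
      {x. visits f x n (- U) \<le> b \<and> x \<notin> U} \<subseteq> \<Union>H \<and>
      (\<forall>P\<in>H. \<forall>x\<in>P. \<forall>y\<in>P. \<forall>i<n. dist ((f ^^ i) x) ((f ^^ i) y) < 2 * \<epsilon>)"
    proof (cases b)
      case 0
      \<comment> \<open>With no bad times allowed nothing is left to cover: for \<open>x\<close>
        outside \<open>U\<close>, time \<open>0\<close> is already bad.\<close>
      have "visits f x n (- U) > 0" if "x \<notin> U" for x
        using False that by (cases n) (auto simp: visits_Suc)
      then show ?thesis
        using 0 by (intro exI[of _ "{}"]) auto
    next
      case (Suc b')
      obtain R where R: "finite R" "card R \<le> ?A ^ ?c (n - 1) * ?B ^ b'"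
        "{x. visits f x (n - 1) (- U) \<le> b'} \<subseteq> \<Union>R"
        "\<And>P x y i. P \<in> R \<Longrightarrow> x \<in> P \<Longrightarrow> y \<in> P \<Longrightarrow> i < n - 1 \<Longrightarrow> dist ((f ^^ i) x) ((f ^^ i) y) < 2 * \<epsilon>"
        using less.IH[of "n - 1" b'] False by auto
      \<comment> \<open>A bad start spends one letter \<open>p\<close> of the net on time
        \<open>0\<close> and one unit of the budget; a piece for length \<open>n - 1\<close>
        containing \<open>f x\<close> handles the rest.\<close>
      define h where "h = (\<lambda>(p, P). {x. dist x p < \<epsilon> \<and> f x \<in> P})"
      define H where "H = h ` (F \<times> R)"
      have "card H \<le> card F * card R"
        unfolding H_def card_cartesian_product[symmetric] using F R by (intro card_image_le) auto
      also have "\<dots> \<le> card F * (?A ^ ?c n * ?B ^ b')"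
      proof -
        have "?A ^ ?c (n - 1) \<le> ?A ^ ?c n"
          using pos by (intro power_increasing div_le_mono) auto
        then show ?thesis
          using R(2) by (meson le_trans mult_le_mono1 mult_le_mono2)
      qed
      finally have "2 * card H \<le> 2 * (card F * (?A ^ ?c n * ?B ^ b'))"
        by (rule mult_le_mono2)
      also have "\<dots> = ?A ^ ?c n * ?B ^ b"
        unfolding Suc power_Suc by (simp only: mult_ac)
      finally have card_H: "2 * card H \<le> ?A ^ ?c n * ?B ^ b" .
      have H_dist: "dist ((f ^^ i) x) ((f ^^ i) y) < 2 * \<epsilon>"
        if P: "P \<in> H" "x \<in> P" "y \<in> P" "i < n" for P x y i
      proof -
        obtain p S where p: "S \<in> R" "P = {x. dist x p < \<epsilon> \<and> f x \<in> S}"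
          using P(1) unfolding H_def h_def by auto
        show ?thesis
        proof (cases i)
          case 0
          have "dist x p < \<epsilon>" "dist y p < \<epsilon>"
            using p P by auto
          then show ?thesis
            using dist_triangle2[of x y p] 0 by simp
        next
          case (Suc j)
          then show ?thesis
            using R(4)[of S "f x" "f y" j] p P by (simp add: funpow_swap1)
        qed
      qed
      have "x \<in> \<Union>H" if x: "visits f x n (- U) \<le> b" "x \<notin> U" for x
      proof -
        obtain p where p: "p \<in> F" "dist x p < \<epsilon>"
          using net by blast
        have "visits f (f x) (n - 1) (- U) \<le> b'"
          using x False Suc by (cases n) (auto simp: visits_Suc)
        then obtain P where P: "P \<in> R" "f x \<in> P"
          using R(3) by auto
        have "h (p, P) \<in> H"
          unfolding H_def using p P by (intro imageI SigmaI)
        moreover have "x \<in> h (p, P)"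
          using p P by (simp add: h_def)
        ultimately show ?thesis
          by (rule UnionI)
      qed
      then show ?thesis
        using card_H H_dist F R by (intro exI[of _ H]) (auto simp: H_def)
    qed
    then obtain H where H: "finite H" "2 * card H \<le> ?A ^ ?c n * ?B ^ b"
      "{x. visits f x n (- U) \<le> b \<and> x \<notin> U} \<subseteq> \<Union>H"
      "\<forall>P\<in>H. \<forall>x\<in>P. \<forall>y\<in>P. \<forall>i<n. dist ((f ^^ i) x) ((f ^^ i) y) < 2 * \<epsilon>"
      by (elim exE conjE) (rule that)
    have "card (G \<union> H) \<le> ?A ^ ?c n * ?B ^ b"
      using card_Un_le[of G H] card_G H(2) by linarith
    moreover have "finite (G \<union> H)"
      using H E Q by (auto simp: G_def)
    moreover have "{x. visits f x n (- U) \<le> b} \<subseteq> \<Union>(G \<union> H)"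
    proof
      fix x assume "x \<in> {x. visits f x n (- U) \<le> b}"
      then have x: "visits f x n (- U) \<le> b" by simp
      show "x \<in> \<Union>(G \<union> H)"
        using G_cover[OF x] H(3) x by (cases "x \<in> U") auto
    qed
    moreover have "\<forall>P\<in>G \<union> H. \<forall>x\<in>P. \<forall>y\<in>P. \<forall>i<n. dist ((f ^^ i) x) ((f ^^ i) y) < 2 * \<epsilon>"
    proof
      fix P assume "P \<in> G \<union> H"
      then show "\<forall>x\<in>P. \<forall>y\<in>P. \<forall>i<n. dist ((f ^^ i) x) ((f ^^ i) y) < 2 * \<epsilon>"
        using G_dist H(4) by auto
    qed
    ultimately show ?thesis
      by (intro exI conjI)
  qed
qed

section \<open>Spanning sets obtained from covers\<close>

lemma dyn_dist_less_iff:
  "n > 0 \<Longrightarrow> dyn_dist f n x y < \<epsilon> \<longleftrightarrow> (\<forall>i<n. dist ((f ^^ i) x) ((f ^^ i) y) < \<epsilon>)"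
  unfolding dyn_dist_def by (subst Max_less_iff) (auto simp: lessThan_empty_iff)

lemma spanning_nonempty: "spanning f A n \<epsilon> E \<Longrightarrow> A \<noteq> {} \<Longrightarrow> E \<noteq> {}"
  by (auto simp: spanning_def)

lemma spanning_mono:
  "spanning f A n \<epsilon> E \<Longrightarrow> \<epsilon> \<le> \<delta> \<Longrightarrow> spanning f A n \<delta> E"
  unfolding spanning_def by (meson less_le_trans)

lemma spanning_of_cover:
  assumes "n > 0" "finite \<P>" "\<Union>\<P> = UNIV"
    and "\<And>P x y i. P \<in> \<P> \<Longrightarrow> x \<in> P \<Longrightarrow> y \<in> P \<Longrightarrow> i < n \<Longrightarrow> dist ((f ^^ i) x) ((f ^^ i) y) < \<delta>"
  shows "\<exists>E. spanning f UNIV n \<delta> E \<and> finite E \<and> card E \<le> card \<P>"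
proof (intro exI conjI)
  \<comment> \<open>An empty piece contributes an arbitrary point, which is harmless because only
    membership in \<open>UNIV\<close> and the count matter.\<close>
  let ?E = "(\<lambda>P. SOME x. x \<in> P) ` \<P>"
  show "finite ?E" "card ?E \<le> card \<P>"
    using assms card_image_le by auto
  show "spanning f UNIV n \<delta> ?E"
    unfolding spanning_def
  proof (intro conjI ballI subset_UNIV)
    fix x
    obtain P where P: "P \<in> \<P>" "x \<in> P"
      using assms(3) by blast
    have "(SOME x. x \<in> P) \<in> P"
      using P(2) by (rule someI)
    then have "dyn_dist f n x (SOME x. x \<in> P) < \<delta>"
      using P assms by (simp add: dyn_dist_less_iff)
    then show "\<exists>y\<in>?E. dyn_dist f n x y < \<delta>"
      using P by blast
  qed
qed

text \<open>The three factors \<open>1 + \<delta>\<close> pay for the factor 2 per block, for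
  rounding up the number of blocks, and for the bad times. The block length \<open>N\<close> is
  fixed first; only then is the set \<open>U\<close> available whose complement is to be visited
  rarely.\<close>

lemma spanning_essential_set_imp_spanning:
  fixes f :: "'a::metric_space \<Rightarrow> 'a"
  assumes X: "compact (UNIV :: 'a set)" and f: "continuous_on UNIV f"
    and \<epsilon>: "\<epsilon> > 0" and \<delta>: "\<delta> > 0" and q: "q \<ge> 0"
    and span: "\<forall>\<^sub>F n in sequentially.
      \<exists>E. spanning f (essential_set f) n \<epsilon> E \<and> finite E \<and> real (card E) \<le> q ^ n"
  shows "\<forall>\<^sub>F n in sequentially.
      \<exists>E. spanning f UNIV n (2 * \<epsilon>) E \<and> finite E \<and> real (card E) \<le> (q * (1 + \<delta>) ^ 3) ^ n"
proof -
  obtain N0 where N0: "\<And>n. n \<ge> N0 \<Longrightarrow>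
      \<exists>E. spanning f (essential_set f) n \<epsilon> E \<and> finite E \<and> real (card E) \<le> q ^ n"
    using span by (auto simp: eventually_sequentially)
  \<comment> \<open>For blocks of length at least \<open>N1\<close>, the factor 2 in
    \<open>2 * card E\<close> costs at most one \<open>1 + \<delta>\<close> per step.\<close>
  obtain N1 where N1: "2 < (1 + \<delta>) ^ N1"
    using real_arch_pow[of "1 + \<delta>" 2] \<delta> by auto
  define N where "N = Suc (max N0 N1)"
  have N: "N > 0" "N \<ge> N0" "N \<ge> N1"
    by (auto simp: N_def)
  obtain E where E: "spanning f (essential_set f) N \<epsilon> E" "finite E" "real (card E) \<le> q ^ N"
    using N0 N by blast
  have "E \<noteq> {}"
    using spanning_nonempty[OF E(1)] essential_set_nonempty[OF X f] by auto
  define U where "U = {x. \<exists>y\<in>E. \<forall>i<N. dist ((f ^^ i) x) ((f ^^ i) y) < \<epsilon>}"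
  have contn: "continuous_on UNIV (f ^^ i)" for i
  proof (induction i)
    case 0
    then show ?case by (simp add: id_def)
  next
    case (Suc i)
    then show ?case
      unfolding funpow.simps by (rule continuous_on_compose) (rule continuous_on_subset[OF f subset_UNIV])
  qed
  have "U = (\<Union>y\<in>E. \<Inter>i<N. {x. dist ((f ^^ i) x) ((f ^^ i) y) < \<epsilon>})"
    by (auto simp: U_def)
  also have "open \<dots>"
    by (intro open_UN ballI open_INT finite_lessThan open_Collect_less continuous_intros contn)
  finally have "open U" .
  have "essential_set f \<subseteq> U"
    using E(1) N(1) by (auto simp: spanning_def U_def dyn_dist_less_iff)
  have "(UNIV :: 'a set) \<subseteq> (\<Union>p\<in>UNIV. ball p \<epsilon>)"
    using \<epsilon> by (meson UN_I UNIV_I centre_in_ball subsetI)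
  then obtain F :: "'a set" where F: "finite F" "UNIV \<subseteq> (\<Union>p\<in>F. ball p \<epsilon>)"
    using compactE_image[OF X, of UNIV "\<lambda>p. ball p \<epsilon>"] open_ball by metis
  have net: "\<exists>p\<in>F. dist x p < \<epsilon>" for x :: 'a
    using subsetD[OF F(2) UNIV_I, of x] by (auto simp: dist_commute)
  then have "F \<noteq> {}" by auto
  define B where "B = 2 * card F"
  \<comment> \<open>\<open>M\<close> is chosen so that bad times of density \<open>1 / Suc M\<close>
    contribute at most \<open>(1 + \<delta>) ^ n\<close>; the successor keeps the denominator
    nonzero.\<close>
  obtain M where "real B < (1 + \<delta>) ^ M"
    using real_arch_pow[of "1 + \<delta>" "real B"] \<delta> by auto
  moreover have "(1 + \<delta>) ^ M \<le> (1 + \<delta>) ^ Suc M"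
    using \<delta> by (intro power_increasing) auto
  ultimately have M: "real B \<le> (1 + \<delta>) ^ Suc M"
    by linarith
  obtain n1 where n1: "\<And>n x. n \<ge> n1 \<Longrightarrow> real (visits f x n (- U)) \<le> 1 / real (Suc M) * real n"
    using visits_outside_essential_set[OF X f \<open>open U\<close> \<open>essential_set f \<subseteq> U\<close>, of "1 / real (Suc M)"]
    by auto
  define s where "s = q * (1 + \<delta>)"
  have "s \<ge> 0"
    using q \<delta> by (simp add: s_def)
  \<comment> \<open>Beyond \<open>n2\<close>, the surplus \<open>s ^ N\<close> of an incomplete last
    block is absorbed by \<open>(1 + \<delta>) ^ n\<close>.\<close>
  obtain n2 where n2: "s ^ N < (1 + \<delta>) ^ n2"
    using real_arch_pow[of "1 + \<delta>" "s ^ N"] \<delta> by auto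
  have "2 \<le> (1 + \<delta>) ^ N"
    using N1 N(3) \<delta> power_increasing[of N1 N "1 + \<delta>"] by linarith
  then have A: "real (2 * card E) \<le> s ^ N"
    unfolding s_def power_mult_distrib using E(3) q mult_mono[of "real (card E)" "q ^ N" 2 "(1 + \<delta>) ^ N"]
    by (simp add: mult.commute)
  moreover have "1 \<le> card E"
    using E \<open>E \<noteq> {}\<close> by (simp add: card_gt_0_iff Suc_le_eq)
  ultimately have "1 \<le> s ^ N"
    by linarith
  \<comment> \<open>This allows the exponent of \<open>s\<close> to be enlarged later; it rests on
    \<open>E\<close> being nonempty.\<close>
  then have s: "1 \<le> s"
    using \<open>s \<ge> 0\<close> N(1) power_less_one_iff[of s N] by linarith
  have "\<exists>E. spanning f UNIV n (2 * \<epsilon>) E \<and> finite E \<and> real (card E) \<le> (q * (1 + \<delta>) ^ 3) ^ n"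
    if n: "n \<ge> Suc (max n1 n2)" for n
  proof -
    let ?k = "(n + N - 1) div N" and ?b = "n div Suc M"
    have visits_le: "visits f x n (- U) \<le> ?b" for x
    proof -
      have "real (visits f x n (- U)) * real (Suc M) \<le> real n"
        using n1[of n x] n by (simp add: field_simps)
      then have "visits f x n (- U) * Suc M \<le> n"
        by (metis of_nat_le_iff of_nat_mult)
      then show ?thesis
        by (simp add: less_eq_div_iff_mult_less_eq)
    qed
    then have "{x. visits f x n (- U) \<le> ?b} = UNIV"
      by blast
    with orbit_cover_count[OF N(1) E(2) \<open>E \<noteq> {}\<close> F(1) \<open>F \<noteq> {}\<close> net, where n = n and b = ?b and f = f]
    obtain \<P> where P: "finite \<P>" "card \<P> \<le> (2 * card E) ^ ?k * B ^ ?b" "UNIV \<subseteq> \<Union>\<P>"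
      "\<forall>P\<in>\<P>. \<forall>x\<in>P. \<forall>y\<in>P. \<forall>i<n. dist ((f ^^ i) x) ((f ^^ i) y) < 2 * \<epsilon>"
      unfolding U_def[symmetric] B_def[symmetric] by (elim exE conjE) simp
    obtain E' where E': "spanning f UNIV n (2 * \<epsilon>) E'" "finite E'" "card E' \<le> card \<P>"
      using spanning_of_cover[OF _ P(1), of n f "2 * \<epsilon>"] P(3,4) n by auto
    have A_pow: "real (2 * card E) ^ ?k \<le> s ^ n * (1 + \<delta>) ^ n"
    proof -
      have "real (2 * card E) ^ ?k \<le> (s ^ N) ^ ?k"
        using A by (intro power_mono) auto
      also have "\<dots> = s ^ (N * ?k)"
        by (simp add: power_mult)
      also have "\<dots> \<le> s ^ (n + N)"
        using s order_trans[OF times_div_less_eq_dividend[of N "n + N - 1"], of "n + N"]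
        by (intro power_increasing) auto
      also have "\<dots> = s ^ n * s ^ N"
        by (rule power_add)
      also have "\<dots> \<le> s ^ n * (1 + \<delta>) ^ n"
      proof -
        have "(1 + \<delta>) ^ n2 \<le> (1 + \<delta>) ^ n"
          using n \<delta> by (intro power_increasing) auto
        then show ?thesis
          using n2 \<open>s \<ge> 0\<close> by (intro mult_left_mono) auto
      qed
      finally show ?thesis .
    qed
    have B_pow: "real B ^ ?b \<le> (1 + \<delta>) ^ n"
    proof -
      have "real B ^ ?b \<le> ((1 + \<delta>) ^ Suc M) ^ ?b"
        using M by (intro power_mono) auto
      also have "\<dots> = (1 + \<delta>) ^ (Suc M * ?b)"
        by (simp only: power_mult)
      also have "\<dots> \<le> (1 + \<delta>) ^ n"
        using \<delta> by (intro power_increasing times_div_less_eq_dividend) auto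
      finally show ?thesis .
    qed
    have "real (card E') \<le> real ((2 * card E) ^ ?k * B ^ ?b)"
      using E'(3) P(2) by linarith
    also have "\<dots> = real (2 * card E) ^ ?k * real B ^ ?b"
      by simp
    also have "\<dots> \<le> (s ^ n * (1 + \<delta>) ^ n) * (1 + \<delta>) ^ n"
      using \<delta> \<open>s \<ge> 0\<close> by (intro mult_mono A_pow B_pow) auto
    also have "\<dots> = (q * (1 + \<delta>) ^ 3) ^ n"
      by (simp add: s_def power3_eq_cube mult.assoc flip: power_mult_distrib)
    finally have "real (card E') \<le> (q * (1 + \<delta>) ^ 3) ^ n" .
    with E' show ?thesis by blast
  qed
  then show ?thesis
    unfolding eventually_sequentially by blast
qed

section \<open>Growth rates\<close>

lemma ecard_finite: "finite E \<Longrightarrow> ecard E = ennreal (real (card E))"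
  by (simp add: ecard_def emeasure_count_space ennreal_of_nat_eq_real_of_nat)

lemma ecard_infinite: "infinite E \<Longrightarrow> ecard E = \<infinity>"
  by (simp add: ecard_def emeasure_count_space)

text \<open>The bridge between roots in \<open>ennreal\<close> and real counting bounds. A real
  \<open>c\<close> excludes infinite sets, and \<open>n > 0\<close> matters because
  \<open>root 0\<close> is constantly \<open>0\<close>.\<close>

lemma eroot_ecard_le_iff:
  assumes n: "n > 0" and c: "c \<ge> 0"
  shows "eroot n (ecard E) \<le> ennreal c \<longleftrightarrow> finite E \<and> real (card E) \<le> c ^ n"
proof (cases "finite E")
  case True
  have "root n (real (card E)) \<le> c \<longleftrightarrow> root n (real (card E)) \<le> root n (c ^ n)"
    using n c by (simp add: real_root_power_cancel)
  also have "\<dots> \<longleftrightarrow> real (card E) \<le> c ^ n"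
    using n by (rule real_root_le_iff)
  finally show ?thesis
    using True n c by (simp add: eroot_def ecard_finite)
next
  case False
  then show ?thesis
    by (simp add: eroot_def ecard_infinite top_unique)
qed

lemma eroot_ecard_ge_1:
  assumes n: "n > 0" and E: "E \<noteq> {}"
  shows "1 \<le> eroot n (ecard E)"
proof (cases "finite E")
  case True
  then have "1 \<le> real (card E)"
    using E by (simp add: card_gt_0_iff Suc_le_eq)
  then have "1 \<le> root n (real (card E))"
    using n by simp
  then have "ennreal 1 \<le> ennreal (root n (real (card E)))"
    by (rule ennreal_leI)
  then show ?thesis
    using True by (simp add: eroot_def ecard_finite)
next
  case False
  then show ?thesis
    by (simp add: eroot_def ecard_infinite)
qed

lemma card_le_card_image_times_fibre:
  fixes d :: real
  assumes "finite (h ` E)" and fib: "\<And>z. z \<in> h ` E \<Longrightarrow> finite {x \<in> E. h x = z} \<and> real (card {x \<in> E. h x = z}) \<le> d"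
  shows "finite E \<and> real (card E) \<le> real (card (h ` E)) * d"
proof
  have "E = (\<Union>z\<in>h ` E. {x \<in> E. h x = z})"
    by auto
  then show E: "finite E"
    using assms by (metis (no_types, lifting) finite_UN)
  have "real (card E) = (\<Sum>z\<in>h ` E. \<Sum>x\<in>{x \<in> E. h x = z}. 1)"
    using sum.image_gen[OF E, of "\<lambda>_. 1 :: real" h] by simp
  also have "\<dots> \<le> (\<Sum>z\<in>h ` E. d)"
    using fib by (intro sum_mono) auto
  finally show "real (card E) \<le> real (card (h ` E)) * d"
    by simp
qed

section \<open>Limits in the scale and extended logarithms\<close>

lemma Lim_at_right_0_antimono:
  fixes g :: "real \<Rightarrow> ennreal"
  assumes anti: "\<And>x y. 0 < x \<Longrightarrow> x \<le> y \<Longrightarrow> g y \<le> g x"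
  shows "Lim (at_right 0) g = (SUP x\<in>{0<..}. g x)"
\<comment> \<open>\<open>Lim\<close> is a definite description, so convergence has to be shown; by
  monotonicity the limit is the supremum.\<close>
proof (rule tendsto_Lim[OF trivial_limit_at_right_real order_tendstoI])
  fix a assume "a < (SUP x\<in>{0<..}. g x)"
  then obtain x where x: "0 < x" "a < g x"
    by (auto simp: less_SUP_iff)
  have "a < g y" if "0 < y" "y < x" for y
    using anti[of y x] x that by (simp add: less_le_trans)
  then show "\<forall>\<^sub>F y in at_right 0. a < g y"
    unfolding eventually_at_right_field using x(1) by blast
next
  fix a assume a: "(SUP x\<in>{0<..}. g x) < a"
  have "g y < a" if "0 < y" for y
    using le_less_trans[OF SUP_upper[of y "{0<..}" g] a] that by simp
  then show "\<forall>\<^sub>F y in at_right 0. g y < a"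
    unfolding eventually_at_right_field by (intro exI[of _ 1]) auto
qed

lemma eln_mono: "a \<le> b \<Longrightarrow> eln a \<le> eln b"
  by (cases a; cases b) (auto simp: eln_def top_unique)

text \<open>Only an inequality: the product of \<open>0\<close> and \<open>\<infinity>\<close> is
  \<open>0\<close>, with logarithm \<open>-\<infinity>\<close>, whereas
  \<open>-\<infinity> + \<infinity>\<close> is \<open>\<infinity>\<close> in
  \<open>ereal\<close>.\<close>

lemma eln_mult_le: "eln (a * b) \<le> eln a + eln b"
proof (cases "a = 0 \<or> b = 0 \<or> a = \<infinity> \<or> b = \<infinity>")
  case True
  then show ?thesis
    by (auto simp: eln_def)
next
  case False
  then obtain x y where "a = ennreal x" "b = ennreal y" "x > 0" "y > 0"
    by (cases a; cases b) (auto simp: less_le)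
  then show ?thesis
    by (simp add: eln_def ln_mult flip: ennreal_mult)
qed

text \<open>This and the next two definitions are the quantities of the theorem before the logarithm
  and any limit in \<open>\<epsilon>\<close>, so that the estimate can be proved multiplicatively at
  each scale.\<close>

definition span_growth :: "('a::metric_space \<Rightarrow> 'a) \<Rightarrow> real \<Rightarrow> ennreal" where
  "span_growth f \<epsilon> = limsup (\<lambda>n. INF E\<in>{E. spanning f UNIV n \<epsilon> E}. eroot n (ecard E))"

definition forward_growth :: "('a::metric_space \<Rightarrow> 'a) \<Rightarrow> real \<Rightarrow> ennreal" where
  "forward_growth f \<epsilon> = limsup (\<lambda>n.
     INF E\<in>{E. spanning f (essential_set f) n \<epsilon> E}. eroot n (ecard ((f ^^ n) ` E)))"

definition preimage_growth :: "('a::metric_space \<Rightarrow> 'a) \<Rightarrow> ennreal" where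
  "preimage_growth f =
     limsup (\<lambda>n. SUP x\<in>essential_set f. eroot n (ecard (essential_preimage f n x)))"

lemma span_growth_antimono: "x \<le> y \<Longrightarrow> span_growth f y \<le> span_growth f x"
  unfolding span_growth_def
  by (intro Limsup_mono always_eventually allI INF_superset_mono) (auto intro: spanning_mono)

lemma forward_growth_antimono: "x \<le> y \<Longrightarrow> forward_growth f y \<le> forward_growth f x"
  unfolding forward_growth_def
  by (intro Limsup_mono always_eventually allI INF_superset_mono) (auto intro: spanning_mono)

text \<open>Together with the same bound for \<open>preimage_growth\<close>, this excludes the
  product \<open>0 * \<infinity>\<close> and makes finite rates positive.\<close>

lemma forward_growth_ge_1:
  assumes "essential_set f \<noteq> {}"
  shows "1 \<le> forward_growth f \<epsilon>"
  unfolding forward_growth_def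
proof (rule le_Limsup)
  show "\<forall>\<^sub>F n in sequentially. 1 \<le> (INF E\<in>{E. spanning f (essential_set f) n \<epsilon> E}. eroot n (ecard ((f ^^ n) ` E)))"
    using eventually_gt_at_top[of 0]
    by eventually_elim (use assms in \<open>auto intro!: INF_greatest eroot_ecard_ge_1 dest: spanning_nonempty\<close>)
qed simp

text \<open>For essential \<open>y\<close> the fibre over its \<open>n\<close>-th image contains
  \<open>y\<close>, and that image is again essential.\<close>

lemma preimage_growth_ge_1:
  assumes f: "continuous_on UNIV f" and "essential_set f \<noteq> {}"
  shows "1 \<le> preimage_growth f"
  unfolding preimage_growth_def
proof (rule le_Limsup)
  obtain y where y: "y \<in> essential_set f"
    using assms by blast
  show "\<forall>\<^sub>F n in sequentially. 1 \<le> (SUP x\<in>essential_set f. eroot n (ecard (essential_preimage f n x)))"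
    using eventually_gt_at_top[of 0]
  proof eventually_elim
    case (elim n)
    have "y \<in> essential_preimage f n ((f ^^ n) y)"
      using y by (simp add: essential_preimage_def)
    then have "1 \<le> eroot n (ecard (essential_preimage f n ((f ^^ n) y)))"
      using elim by (intro eroot_ecard_ge_1) auto
    then show ?case
      using essential_set_funpow[OF f y] by (intro SUP_upper2)
  qed
qed simp

text \<open>Strict inequality for the upper limits gives, for large \<open>n\<close>, a spanning set
  with at most \<open>c ^ n\<close> images under \<open>f ^^ n\<close> and fibres of at most
  \<open>d ^ n\<close> points.\<close>

lemma eventually_spanning_essential_set:
  assumes f: "continuous_on UNIV f"
    and c: "forward_growth f \<epsilon> < ennreal c" and d: "preimage_growth f < ennreal d"
  shows "\<forall>\<^sub>F n in sequentially.
    \<exists>E. spanning f (essential_set f) n \<epsilon> E \<and> finite E \<and> real (card E) \<le> (c * d) ^ n"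
proof -
  \<comment> \<open>\<open>ennreal\<close> truncates nonpositive reals to \<open>0\<close>, and
    nothing lies strictly below \<open>0\<close>.\<close>
  have pos: "c > 0" "d > 0"
    using c d by (metis ennreal_neg le_less_linear not_less_zero)+
  have "\<forall>\<^sub>F n in sequentially. (INF E\<in>{E. spanning f (essential_set f) n \<epsilon> E}. eroot n (ecard ((f ^^ n) ` E))) < ennreal c"
    using c unfolding forward_growth_def by (rule Limsup_lessD)
  moreover have "\<forall>\<^sub>F n in sequentially. (SUP x\<in>essential_set f. eroot n (ecard (essential_preimage f n x))) < ennreal d"
    using d unfolding preimage_growth_def by (rule Limsup_lessD)
  ultimately show ?thesis
    using eventually_gt_at_top[of 0]
  proof eventually_elim
    case (elim n)
    from elim(1) obtain E where E: "spanning f (essential_set f) n \<epsilon> E" "eroot n (ecard ((f ^^ n) ` E)) < ennreal c"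
      by (auto simp: INF_less_iff)
    have image: "finite ((f ^^ n) ` E) \<and> real (card ((f ^^ n) ` E)) \<le> c ^ n"
      using eroot_ecard_le_iff[OF elim(3), of c "(f ^^ n) ` E"] E(2) pos by (simp add: less_imp_le)
    have "finite E \<and> real (card E) \<le> real (card ((f ^^ n) ` E)) * d ^ n"
    proof (rule card_le_card_image_times_fibre)
      fix z assume "z \<in> (f ^^ n) ` E"
      moreover have sub: "E \<subseteq> essential_set f"
        using E(1) by (simp add: spanning_def)
      \<comment> \<open>Forward invariance makes \<open>z\<close> essential, so the supremum over
        essential points bounds its fibre.\<close>
      ultimately have "z \<in> essential_set f"
        using essential_set_funpow[OF f] by auto
      then have "eroot n (ecard (essential_preimage f n z)) \<le> ennreal d"
        using elim(2) by (meson SUP_lessD less_imp_le)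
      then have fib: "finite (essential_preimage f n z)" "real (card (essential_preimage f n z)) \<le> d ^ n"
        using eroot_ecard_le_iff[OF elim(3), of d "essential_preimage f n z"] pos by (simp_all add: less_imp_le)
      have "{x \<in> E. (f ^^ n) x = z} \<subseteq> essential_preimage f n z"
        using sub by (auto simp: essential_preimage_def)
      then show "finite {x \<in> E. (f ^^ n) x = z} \<and> real (card {x \<in> E. (f ^^ n) x = z}) \<le> d ^ n"
        using fib card_mono[OF fib(1)] finite_subset by (meson of_nat_mono order_trans)
    qed (use image in simp)
    moreover have "real (card ((f ^^ n) ` E)) * d ^ n \<le> (c * d) ^ n"
      using image pos by (simp add: power_mult_distrib mult_right_mono)
    ultimately show ?case
      using E(1) by (intro exI[of _ E]) simp
  qed
qed

lemma span_growth_le: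
  fixes f :: "'a::metric_space \<Rightarrow> 'a"
  assumes X: "compact (UNIV :: 'a set)" and f: "continuous_on UNIV f" and \<epsilon>: "\<epsilon> > 0"
  shows "span_growth f (2 * \<epsilon>) \<le> forward_growth f \<epsilon> * preimage_growth f"
proof (cases "forward_growth f \<epsilon> = \<infinity> \<or> preimage_growth f = \<infinity>")
  case True
  moreover have "forward_growth f \<epsilon> \<noteq> 0" "preimage_growth f \<noteq> 0"
    using forward_growth_ge_1[of f \<epsilon>] preimage_growth_ge_1[OF f] essential_set_nonempty[OF X f] by auto
  ultimately have "forward_growth f \<epsilon> * preimage_growth f = \<infinity>"
    by (auto simp: ennreal_mult_eq_top_iff)
  then show ?thesis by simp
next
  case False
  then obtain g w where g: "forward_growth f \<epsilon> = ennreal g" "0 \<le> g"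
    and w: "preimage_growth f = ennreal w" "0 \<le> w"
    by (metis ennreal_cases infinity_ennreal_def)
  have pos: "0 < g" "0 < w"
    using forward_growth_ge_1[of f \<epsilon>] preimage_growth_ge_1[OF f] essential_set_nonempty[OF X f] g w
    by (auto simp: less_le)
  have le: "span_growth f (2 * \<epsilon>) \<le> ennreal (g * w * (1 + \<delta>) ^ 5)" if \<delta>: "\<delta> > 0" for \<delta>
  proof -
    \<comment> \<open>A factor \<open>1 + \<delta>\<close> on each rate provides the strict
      inequalities; with the three lost in passing to the whole space this gives the fifth
      power.\<close>
    define q where "q = (g * (1 + \<delta>)) * (w * (1 + \<delta>))"
    have q: "q \<ge> 0"
      using pos \<delta> by (simp add: q_def)
    have "forward_growth f \<epsilon> < ennreal (g * (1 + \<delta>))" "preimage_growth f < ennreal (w * (1 + \<delta>))"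
      using pos \<delta> by (auto simp: g w ennreal_less_iff algebra_simps)
    from eventually_spanning_essential_set[OF f this]
    have "\<forall>\<^sub>F n in sequentially.
      \<exists>E. spanning f (essential_set f) n \<epsilon> E \<and> finite E \<and> real (card E) \<le> q ^ n"
      by (simp add: q_def)
    from spanning_essential_set_imp_spanning[OF X f \<epsilon> \<delta> q this] eventually_gt_at_top[of 0]
    have "\<forall>\<^sub>F n in sequentially. (INF E\<in>{E. spanning f UNIV n (2 * \<epsilon>) E}. eroot n (ecard E)) \<le> ennreal (q * (1 + \<delta>) ^ 3)"
    proof eventually_elim
      case (elim n)
      then obtain E where "spanning f UNIV n (2 * \<epsilon>) E" "finite E" "real (card E) \<le> (q * (1 + \<delta>) ^ 3) ^ n"
        by blast
      moreover from this have "eroot n (ecard E) \<le> ennreal (q * (1 + \<delta>) ^ 3)"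
        using elim q \<delta> by (subst eroot_ecard_le_iff) auto
      ultimately show ?case
        by (intro INF_lower2[of E]) auto
    qed
    then have "span_growth f (2 * \<epsilon>) \<le> ennreal (q * (1 + \<delta>) ^ 3)"
      unfolding span_growth_def by (rule Limsup_bounded)
    also have "q * (1 + \<delta>) ^ 3 = g * w * (1 + \<delta>) ^ 5"
      by (simp add: q_def power_numeral_reduce algebra_simps)
    finally show ?thesis .
  qed
  have "((\<lambda>\<delta>. g * w * (1 + \<delta>) ^ 5) \<longlongrightarrow> g * w * (1 + 0) ^ 5) (at_right 0)"
    by (intro tendsto_intros)
  then have "((\<lambda>\<delta>. ennreal (g * w * (1 + \<delta>) ^ 5)) \<longlongrightarrow> ennreal (g * w)) (at_right 0)"
    by (intro tendsto_ennrealI) simp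
  moreover have "\<forall>\<^sub>F \<delta> in at_right 0. span_growth f (2 * \<epsilon>) \<le> ennreal (g * w * (1 + \<delta>) ^ 5)"
    using le by (auto simp: eventually_at_right_field intro!: exI[of _ 1])
  ultimately have "span_growth f (2 * \<epsilon>) \<le> ennreal (g * w)"
    by (rule tendsto_lowerbound) simp
  then show ?thesis
    using g w by (simp add: ennreal_mult)
qed

theorem lemma7:
  fixes \<alpha> :: "'a::metric_space \<Rightarrow> 'a"
  assumes "compact (UNIV :: 'a set)"
    and "continuous_on UNIV \<alpha>"
    and "finite_sheeted_on_essential \<alpha>"
  shows "topological_entropy \<alpha> \<le> forward_entropy \<alpha> + inverse_rami_rate \<alpha>"
proof -
  have h: "topological_entropy \<alpha> = eln (SUP \<epsilon>\<in>{0<..}. span_growth \<alpha> \<epsilon>)"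
    unfolding topological_entropy_def span_growth_def[symmetric]
    by (subst Lim_at_right_0_antimono) (auto intro: span_growth_antimono)
  have \<gamma>: "forward_entropy \<alpha> = eln (SUP \<epsilon>\<in>{0<..}. forward_growth \<alpha> \<epsilon>)"
    unfolding forward_entropy_def forward_growth_def[symmetric]
    by (subst Lim_at_right_0_antimono) (auto intro: forward_growth_antimono)
  have "(SUP \<epsilon>\<in>{0<..}. span_growth \<alpha> \<epsilon>) \<le> (SUP \<epsilon>\<in>{0<..}. forward_growth \<alpha> \<epsilon>) * preimage_growth \<alpha>"
  proof (rule SUP_least)
    fix \<epsilon> :: real assume "\<epsilon> \<in> {0<..}"
    \<comment> \<open>Halving compensates for the doubled scale and is immaterial in the supremum
      over all scales.\<close>
    then have \<epsilon>: "\<epsilon> / 2 > 0" by simp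
    have "span_growth \<alpha> \<epsilon> \<le> forward_growth \<alpha> (\<epsilon> / 2) * preimage_growth \<alpha>"
      using span_growth_le[OF assms(1,2) \<epsilon>] by simp
    also have "\<dots> \<le> (SUP \<epsilon>\<in>{0<..}. forward_growth \<alpha> \<epsilon>) * preimage_growth \<alpha>"
      using \<epsilon> by (intro mult_right_mono SUP_upper) auto
    finally show "span_growth \<alpha> \<epsilon> \<le> (SUP \<epsilon>\<in>{0<..}. forward_growth \<alpha> \<epsilon>) * preimage_growth \<alpha>" .
  qed
  then have "topological_entropy \<alpha> \<le> eln ((SUP \<epsilon>\<in>{0<..}. forward_growth \<alpha> \<epsilon>) * preimage_growth \<alpha>)"
    unfolding h by (rule eln_mono)
  also have "\<dots> \<le> forward_entropy \<alpha> + inverse_rami_rate \<alpha>"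
    unfolding \<gamma> inverse_rami_rate_def preimage_growth_def[symmetric] by (rule eln_mult_le)
  finally show ?thesis .
qed

end
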